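(* For every convex function $f:\mathbb{R}^n\to\mathbb{R}$ there exist a unique linear subspace $X_f$ of $\mathbb{R}^n$, a unique vector $v_f\in X_f^{\perp}$, and a unique essentially coercive function $c_f:X_f\to\mathbb{R}$ such that $f$ can be written in the form $$f(x)=c_f(P_{X_f}(x))+\langle v_f,x\rangle\quad\text{for all }x\in\mathbb{R}^n.$$ Moreover, if $Y$ is a linear subspace of $\mathbb{R}^n$ such that $f$ is essentially coercive in the direction of $Y$, then $Y\subseteq X_f$.
   Context: For a linear subspace $X$ of $\mathbb{R}^n$, $P_X:\mathbb{R}^n\to X$ denotes the orthogonal projection and $X^{\perp}$ the orthogonal complement. A function $c:X\to\mathbb{R}$ is essentially coercive if there is a linear function $\ell:X\to\mathbb{R}$ such that $\lim_{k\to\infty}(c-\ell)(x_k)=\infty$ for every sequence $(x_k)_k\subset X$ with $\lim_{k\to\infty}|x_k|=\infty$ (so every function on $X=\{0\}$ is essentially coercive). A function $f:\mathbb{R}^n\to\mathbb{R}$ is essentially coercive in the direction of a linear subspace $Y$ (essentially $P_Y$-coercive) if there is a linear function $\ell:\mathbb{R}^n\to\mathbb{R}$ such that $\lim_{k\to\infty}(f-\ell)(x_k)=\infty$ for every sequence $(x_k)_k\subset\mathbb{R}^n$ with $\lim_{k\to\infty}|P_Y(x_k)|=\infty$. *)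

theory Defs
  imports "HOL-Analysis.Analysis"
begin

definition orth_proj :: "'a::euclidean_space set \<Rightarrow> 'a \<Rightarrow> 'a" where
  "orth_proj X x = (THE y. y \<in> X \<and> x - y \<in> X\<^sup>\<bottom>)"

lemma orth_proj_ex1:
  fixes X :: "'a::euclidean_space set"
  assumes "subspace X"
  shows "\<exists>!y. y \<in> X \<and> x - y \<in> X\<^sup>\<bottom>"
proof (rule ex_ex1I)
  obtain y z where "y \<in> span X" "\<And>w. w \<in> span X \<Longrightarrow> orthogonal z w" "x = y + z"
    using orthogonal_subspace_decomp_exists by metis
  moreover from this have "x - y \<in> X\<^sup>\<bottom>"
    by (auto simp: orthogonal_comp_def orthogonal_commute span_base)
  ultimately show "\<exists>y. y \<in> X \<and> x - y \<in> X\<^sup>\<bottom>"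
    using assms by (metis span_eq_iff)
next
  fix y y' assume *: "y \<in> X \<and> x - y \<in> X\<^sup>\<bottom>" "y' \<in> X \<and> x - y' \<in> X\<^sup>\<bottom>"
  then have "y - y' \<in> X" using assms by (simp add: subspace_diff)
  moreover from this * have "inner (y - y') (x - y) = 0" "inner (y - y') (x - y') = 0"
    by (auto simp: orthogonal_comp_def orthogonal_def)
  then have "inner (y - y') (y - y') = 0"
    by (simp add: inner_diff_right)
  ultimately show "y = y'" by simp
qed

definition linear_functional_on :: "'a::real_vector set \<Rightarrow> ('a \<Rightarrow> real) \<Rightarrow> bool" where
  "linear_functional_on X l \<longleftrightarrow>
     (\<forall>x\<in>X. \<forall>y\<in>X. l (x + y) = l x + l y) \<and> (\<forall>r. \<forall>x\<in>X. l (r *\<^sub>R x) = r * l x)"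

definition essentially_coercive_on :: "'a::real_normed_vector set \<Rightarrow> ('a \<Rightarrow> real) \<Rightarrow> bool" where
  "essentially_coercive_on X c \<longleftrightarrow>
     (\<exists>l. linear_functional_on X l \<and>
        (\<forall>x :: nat \<Rightarrow> 'a. (\<forall>k. x k \<in> X) \<longrightarrow> filterlim (\<lambda>k. norm (x k)) at_top sequentially \<longrightarrow>
           filterlim (\<lambda>k. c (x k) - l (x k)) at_top sequentially))"

definition essentially_coercive_in_direction ::
    "'a::euclidean_space set \<Rightarrow> ('a \<Rightarrow> real) \<Rightarrow> bool" where
  "essentially_coercive_in_direction Y f \<longleftrightarrow>
     (\<exists>l :: 'a \<Rightarrow> real. linear l \<and>
        (\<forall>x :: nat \<Rightarrow> 'a. filterlim (\<lambda>k. norm (orth_proj Y (x k))) at_top sequentially \<longrightarrow>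
           filterlim (\<lambda>k. f (x k) - l (x k)) at_top sequentially))"

(* A function on the subspace X is encoded as an extensional function (undefined outside X),
   so that equality of the HOL functions is equality of the functions on X. *)
definition coercive_decomposition ::
    "('a::euclidean_space \<Rightarrow> real) \<Rightarrow> 'a set \<Rightarrow> 'a \<Rightarrow> ('a \<Rightarrow> real) \<Rightarrow> bool" where
  "coercive_decomposition f X v c \<longleftrightarrow>
     subspace X \<and> v \<in> X\<^sup>\<bottom> \<and> c \<in> extensional X \<and> essentially_coercive_on X c \<and>
     (\<forall>x. f x = c (orth_proj X x) + inner v x)"

end

theory Submission
  imports Defs
begin

text \<open>
  Let \<open>S\<close> be the convex set of slopes of the affine minorants of \<open>f\<close>, and pick \<open>l\<close> in its relative
  interior. With \<open>X = span (S - l)\<close>, all slopes agree with \<open>l\<close> on \<open>X\<^sup>\<bottom>\<close>, and since \<open>f\<close> is the supremum of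
  its affine minorants it is affine in the directions of \<open>X\<^sup>\<bottom>\<close>. On \<open>X\<close>, all slopes in a small ball around
  \<open>l\<close> are available, so \<open>f - l\<close> grows at least linearly there.
  Conversely, a function cannot be both affine and coercive along a line, so in any decomposition
  \<open>X\<^sup>\<bottom>\<close> is exactly the set of directions in which \<open>f\<close> is affine; this gives uniqueness and maximality.
\<close>

section \<open>Orthogonal projections\<close>

lemma orth_proj_in:
  assumes "subspace X"
  shows "orth_proj X x \<in> X" and "x - orth_proj X x \<in> X\<^sup>\<bottom>"
  using theI'[OF orth_proj_ex1[OF assms, of x]] by (auto simp: orth_proj_def)

lemma orth_proj_eqI:
  assumes "subspace X" "y \<in> X" "x - y \<in> X\<^sup>\<bottom>"
  shows "orth_proj X x = y"
  unfolding orth_proj_def using orth_proj_ex1[OF assms(1), of x] assms(2,3)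
  by (intro the1_equality) auto

lemma orth_proj_scaleR:
  assumes "subspace X"
  shows "orth_proj X (t *\<^sub>R x) = t *\<^sub>R orth_proj X x"
proof (rule orth_proj_eqI[OF assms])
  show "t *\<^sub>R orth_proj X x \<in> X"
    using orth_proj_in(1)[OF assms] assms by (simp add: subspace_scale)
  show "t *\<^sub>R x - t *\<^sub>R orth_proj X x \<in> X\<^sup>\<bottom>"
    using subspace_scale[OF subspace_orthogonal_comp orth_proj_in(2)[OF assms, of x], of t]
    by (simp add: scaleR_diff_right)
qed

lemma orth_proj_add_orthogonal:
  assumes "subspace X" "w \<in> X\<^sup>\<bottom>"
  shows "orth_proj X (x + w) = orth_proj X x"
proof (rule orth_proj_eqI[OF assms(1)])
  show "orth_proj X x \<in> X"
    by (rule orth_proj_in(1)[OF assms(1)])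
  show "x + w - orth_proj X x \<in> X\<^sup>\<bottom>"
    using subspace_add[OF subspace_orthogonal_comp orth_proj_in(2)[OF assms(1), of x] assms(2)]
    by (simp add: algebra_simps)
qed

lemma orth_proj_self:
  assumes "subspace X" "x \<in> X"
  shows "orth_proj X x = x"
  using assms by (intro orth_proj_eqI) (auto simp: subspace_0 subspace_orthogonal_comp)

lemma inner_orthogonal_comp:
  assumes "x \<in> X" "w \<in> X\<^sup>\<bottom>"
  shows "inner x w = 0" and "inner w x = 0"
  using assms by (auto simp: orthogonal_comp_def orthogonal_def inner_commute)

section \<open>Affine directions and coercivity\<close>

text \<open>The linear parts at \<open>t\<close> and \<open>-t\<close> cancel, so
  \<open>h t + h (- t)\<close> is the constant \<open>2 * p\<close>, which cannot tend to
  infinity.\<close>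

lemma coercive_not_affine:
  fixes h :: "real \<Rightarrow> real"
  assumes "\<And>t. h t = p + t * q"
    and "filterlim (\<lambda>k. h (real k)) at_top sequentially"
    and "filterlim (\<lambda>k. h (- real k)) at_top sequentially"
  shows False
proof -
  have "filterlim (\<lambda>k::nat. h (real k) + h (- real k)) at_top sequentially"
    by (rule filterlim_at_top_add_at_top[OF assms(2,3)])
  then have "filterlim (\<lambda>k::nat. 2 * p) at_top sequentially"
    by (simp add: assms(1))
  then have "eventually (\<lambda>k::nat. 2 * p + 1 \<le> 2 * p) sequentially"
    unfolding filterlim_at_top by blast
  then show False by simp
qed

lemma filterlim_norm_multiples:
  fixes w :: "'a::real_normed_vector"
  assumes "w \<noteq> 0"
  shows "filterlim (\<lambda>k. norm (real k *\<^sub>R w)) at_top sequentially"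
    and "filterlim (\<lambda>k. norm (- real k *\<^sub>R w)) at_top sequentially"
proof -
  have "filterlim (\<lambda>k. real k * norm w) at_top sequentially"
    using assms
    by (intro filterlim_at_top_mult_tendsto_pos[OF tendsto_const _ filterlim_real_sequentially]) auto
  then show "filterlim (\<lambda>k. norm (real k *\<^sub>R w)) at_top sequentially"
    and "filterlim (\<lambda>k. norm (- real k *\<^sub>R w)) at_top sequentially"
    by simp_all
qed

text \<open>Subtracting the linear function that witnesses essential coercivity keeps
  \<open>c\<close> affine along the line, while for \<open>w \<noteq> 0\<close> both half-lines are
  unbounded and force growth at both ends.\<close>

lemma essentially_coercive_on_no_affine_line:
  assumes "subspace X" "essentially_coercive_on X c" "w \<in> X"
    and "\<And>t. c (t *\<^sub>R w) = p + t * q"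
  shows "w = 0"
proof (rule ccontr)
  assume "w \<noteq> 0"
  obtain l where l: "linear_functional_on X l"
    and lim: "\<And>x :: nat \<Rightarrow> 'a. \<lbrakk>\<And>k. x k \<in> X; filterlim (\<lambda>k. norm (x k)) at_top sequentially\<rbrakk>
      \<Longrightarrow> filterlim (\<lambda>k. c (x k) - l (x k)) at_top sequentially"
    using assms(2) unfolding essentially_coercive_on_def by blast
  have mem: "t *\<^sub>R w \<in> X" for t
    using assms(1,3) by (rule subspace_scale)
  show False
  proof (rule coercive_not_affine[where h = "\<lambda>t. c (t *\<^sub>R w) - l (t *\<^sub>R w)"])
    show "c (t *\<^sub>R w) - l (t *\<^sub>R w) = p + t * (q - l w)" for t
      using l assms(3,4) by (simp add: linear_functional_on_def algebra_simps)
  qed (intro lim mem filterlim_norm_multiples \<open>w \<noteq> 0\<close>)+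
qed

text \<open>If \<open>w\<close> had a nonzero projection to \<open>Y\<close>, the projections of its
  positive and negative multiples would be unbounded, so \<open>f\<close> minus a linear function
  would be both affine and coercive along the line.\<close>

lemma essentially_coercive_in_direction_affine_line:
  assumes "subspace Y" "essentially_coercive_in_direction Y f"
    and "\<And>t. f (t *\<^sub>R w) = p + t * q"
  shows "w \<in> Y\<^sup>\<bottom>"
proof -
  obtain l :: "'a \<Rightarrow> real" where l: "linear l"
    and lim: "\<And>x :: nat \<Rightarrow> 'a. filterlim (\<lambda>k. norm (orth_proj Y (x k))) at_top sequentially
      \<Longrightarrow> filterlim (\<lambda>k. f (x k) - l (x k)) at_top sequentially"
    using assms(2) unfolding essentially_coercive_in_direction_def by blast
  have "orth_proj Y w = 0"
  proof (rule ccontr)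
    assume nz: "orth_proj Y w \<noteq> 0"
    show False
    proof (rule coercive_not_affine[where h = "\<lambda>t. f (t *\<^sub>R w) - l (t *\<^sub>R w)"])
      show "f (t *\<^sub>R w) - l (t *\<^sub>R w) = p + t * (q - l w)" for t
        using assms(3) by (simp add: linear_scale[OF l] algebra_simps)
    qed (intro lim, subst orth_proj_scaleR[OF assms(1)], rule filterlim_norm_multiples[OF nz])+
  qed
  then show ?thesis
    using orth_proj_in(2)[OF assms(1), of w] by simp
qed

section \<open>Uniqueness and maximality\<close>

lemma coercive_decompositionD:
  assumes "coercive_decomposition f X v c"
  shows "subspace X" "v \<in> X\<^sup>\<bottom>" "c \<in> extensional X" "essentially_coercive_on X c"
    "f x = c (orth_proj X x) + inner v x"
  using assms by (auto simp: coercive_decomposition_def)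

lemma coercive_decomposition_eq_on:
  assumes "coercive_decomposition f X v c" "x \<in> X"
  shows "f x = c x"
  using coercive_decompositionD[OF assms(1)] assms(2)
  by (simp add: orth_proj_self inner_orthogonal_comp)

lemma coercive_decomposition_affine:
  assumes "coercive_decomposition f X v c" "w \<in> X\<^sup>\<bottom>"
  shows "f (x + t *\<^sub>R w) = f x + t * inner v w"
proof -
  have "t *\<^sub>R w \<in> X\<^sup>\<bottom>"
    using assms(2) by (simp add: subspace_scale subspace_orthogonal_comp)
  then show ?thesis
    using coercive_decompositionD[OF assms(1)]
    by (simp add: orth_proj_add_orthogonal inner_add_right)
qed

text \<open>The right-hand side mentions only \<open>f\<close>, so \<open>X\<^sup>\<bottom>\<close>,
  and with it \<open>X\<close>, is determined by \<open>f\<close>. This is the core of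
  uniqueness.\<close>

lemma coercive_decomposition_affine_iff:
  assumes "coercive_decomposition f X v c"
  shows "w \<in> X\<^sup>\<bottom> \<longleftrightarrow> (\<exists>a. \<forall>x t. f (x + t *\<^sub>R w) = f x + t * a)"
proof
  show "\<exists>a. \<forall>x t. f (x + t *\<^sub>R w) = f x + t * a" if "w \<in> X\<^sup>\<bottom>"
    using coercive_decomposition_affine[OF assms that] by blast
next
  assume "\<exists>a. \<forall>x t. f (x + t *\<^sub>R w) = f x + t * a"
  then obtain a where a: "\<And>x t. f (x + t *\<^sub>R w) = f x + t * a" by blast
  note D = coercive_decompositionD[OF assms]
  define u where "u = orth_proj X w"
  have u: "u \<in> X" "w - u \<in> X\<^sup>\<bottom>"
    using orth_proj_in[OF D(1)] by (auto simp: u_def)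
  have "c (t *\<^sub>R u) = f 0 + t * (a - inner v (w - u))" for t
  proof -
    have "c (t *\<^sub>R u) = f (t *\<^sub>R u)"
      using coercive_decomposition_eq_on[OF assms] u(1) D(1) by (simp add: subspace_scale)
    \<comment> \<open>The point is reached from 0 by two moves: along \<open>w\<close>, affine by
      assumption, and along \<open>w - u\<close> in \<open>X\<^sup>\<bottom>\<close>, affine by the
      decomposition.\<close>
    also have "t *\<^sub>R u = (0 + t *\<^sub>R w) + (- t) *\<^sub>R (w - u)"
      by (simp add: algebra_simps)
    also have "f \<dots> = f 0 + t * a + (- t) * inner v (w - u)"
      by (simp only: coercive_decomposition_affine[OF assms u(2)] a)
    finally show ?thesis by (simp add: algebra_simps)
  qed
  then have "u = 0"
    using essentially_coercive_on_no_affine_line D(1,4) u(1) by blast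
  then show "w \<in> X\<^sup>\<bottom>" using u(2) by simp
qed

lemma coercive_decomposition_unique:
  assumes 1: "coercive_decomposition f X v c" and 2: "coercive_decomposition f X' v' c'"
  shows "X = X'" "v = v'" "c = c'"
proof -
  note D = coercive_decompositionD[OF 1] and D' = coercive_decompositionD[OF 2]
  have "X\<^sup>\<bottom> = X'\<^sup>\<bottom>"
    using coercive_decomposition_affine_iff[OF 1] coercive_decomposition_affine_iff[OF 2] by blast
  then show X: "X = X'"
    using D(1) D'(1) by (metis orthogonal_comp_self)
  have w: "v - v' \<in> X\<^sup>\<bottom>"
    using D(2) D'(2) X by (simp add: subspace_diff subspace_orthogonal_comp)
  \<comment> \<open>Both decompositions compute the same increment of \<open>f\<close> from 0 to
    \<open>v - v'\<close>.\<close>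
  have "inner v (v - v') = inner v' (v - v')"
    using coercive_decomposition_affine[OF 1 w, of 0 1]
      coercive_decomposition_affine[OF 2 w[unfolded X], of 0 1] by simp
  then have "inner (v - v') (v - v') = 0"
    by (simp add: inner_diff_left)
  then show "v = v'" by simp
  show "c = c'"
  proof (rule extensionalityI[of _ X])
    show "c x = c' x" if "x \<in> X" for x
      using coercive_decomposition_eq_on[OF 1 that] coercive_decomposition_eq_on[OF 2] that X by simp
  qed (use D(3) D'(3) X in auto)
qed

text \<open>Every direction in \<open>X\<^sup>\<bottom>\<close> is affine for \<open>f\<close>,
  hence lies in \<open>Y\<^sup>\<bottom>\<close>; taking complements reverses the inclusion.\<close>

lemma coercive_decomposition_maximal:
  assumes "coercive_decomposition f X v c" "subspace Y" "essentially_coercive_in_direction Y f"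
  shows "Y \<subseteq> X"
proof -
  have "w \<in> Y\<^sup>\<bottom>" if "w \<in> X\<^sup>\<bottom>" for w
    using coercive_decomposition_affine[OF assms(1) that, of 0]
    by (intro essentially_coercive_in_direction_affine_line[OF assms(2,3)]) simp
  then have "Y\<^sup>\<bottom>\<^sup>\<bottom> \<subseteq> X\<^sup>\<bottom>\<^sup>\<bottom>"
    by (intro orthogonal_comp_anti_mono[of "X\<^sup>\<bottom>"] subsetI)
  then show ?thesis
    using assms(2) coercive_decompositionD(1)[OF assms(1)] by (simp add: orthogonal_comp_self)
qed

section \<open>Existence\<close>

text \<open>This is the effective domain of the convex conjugate of \<open>f\<close>: the slopes
  \<open>s\<close> for which \<open>inner s x - f x\<close> is bounded above in
  \<open>x\<close>.\<close>

definition minorant_slopes :: "('a::real_inner \<Rightarrow> real) \<Rightarrow> 'a set" where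
  "minorant_slopes f = {s. \<exists>b. \<forall>x. inner s x + b \<le> f x}"

lemma convex_minorant_slopes: "convex (minorant_slopes f)"
proof (rule convexI)
  fix s s' :: 'a and u v :: real
  assume "s \<in> minorant_slopes f" "s' \<in> minorant_slopes f" and uv: "0 \<le> u" "0 \<le> v" "u + v = 1"
  then obtain b b' where b: "\<And>x. inner s x + b \<le> f x" "\<And>x. inner s' x + b' \<le> f x"
    unfolding minorant_slopes_def by blast
  have "inner (u *\<^sub>R s + v *\<^sub>R s') x + (u * b + v * b') \<le> f x" for x
  proof -
    have "inner (u *\<^sub>R s + v *\<^sub>R s') x + (u * b + v * b')
        = u * (inner s x + b) + v * (inner s' x + b')"
      by (simp add: inner_add_left distrib_left)
    also have "\<dots> \<le> u * f x + v * f x"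
      using b uv by (intro add_mono mult_left_mono) auto
    also have "\<dots> = f x"
      using uv(3) by (metis distrib_right mult_1)
    finally show ?thesis .
  qed
  then show "u *\<^sub>R s + v *\<^sub>R s' \<in> minorant_slopes f"
    unfolding minorant_slopes_def by blast
qed

text \<open>The epigraph is closed and convex, so a hyperplane strictly separates it from the point
  lying \<open>\<delta>\<close> below the graph at \<open>x\<close>; solved for the last coordinate,
  it gives the minorant.\<close>

lemma approximate_subgradient:
  fixes f :: "'a::euclidean_space \<Rightarrow> real"
  assumes "convex_on UNIV f" "\<delta> > 0"
  obtains s where "\<And>y. f x - \<delta> + inner s (y - x) \<le> f y"
proof -
  have "continuous_on UNIV (\<lambda>p::'a \<times> real. f (fst p))"
    by (rule continuous_on_compose2[OF convex_on_continuous[OF open_UNIV assms(1)]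
          continuous_on_fst[OF continuous_on_id]]) simp
  then have closed: "closed (epigraph UNIV f)"
    unfolding epigraph_def using closed_Collect_le[OF _ continuous_on_snd[OF continuous_on_id]] by simp
  have "(x, f x - \<delta>) \<notin> epigraph UNIV f"
    using assms(2) by (simp add: epigraph_def)
  then obtain a b where ab: "inner a (x, f x - \<delta>) < b" "\<And>p. p \<in> epigraph UNIV f \<Longrightarrow> b < inner a p"
    using separating_hyperplane_closed_point[OF convex_epigraphI[OF assms(1)] closed] by blast
  obtain p q where a: "a = (p, q)" by (cases a)
  have lower: "inner p x + q * (f x - \<delta>) < b"
    using ab(1) by (simp add: a)
  have upper: "b < inner p y + q * f y" for y
    using ab(2)[of "(y, f y)"] by (simp add: a epigraph_def)
  \<comment> \<open>Comparing the two sides over the same \<open>x\<close> shows that the hyperplane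
    is not vertical.\<close>
  have "0 < q * \<delta>"
    using lower upper[of x] by (simp add: algebra_simps)
  then have "q > 0"
    using assms(2) by (simp add: zero_less_mult_iff)
  have "f x - \<delta> + inner (- p /\<^sub>R q) (y - x) \<le> f y" for y
  proof -
    have "q * (f x - \<delta> + inner (- p /\<^sub>R q) (y - x)) = q * (f x - \<delta>) - inner p (y - x)"
      using \<open>q > 0\<close> by (simp add: right_diff_distrib)
    also have "\<dots> \<le> q * f y"
      using lower upper[of y] by (simp add: inner_diff_right)
    finally show ?thesis
      using \<open>q > 0\<close> by simp
  qed
  then show thesis using that by blast
qed

lemma approximate_subgradient_slope:
  assumes "\<And>y. f x - \<delta> + inner s (y - x) \<le> f y"
  shows "s \<in> minorant_slopes f"
  unfolding minorant_slopes_def mem_Collect_eq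
proof (intro exI allI)
  show "inner s y + (f x - \<delta> - inner s x) \<le> f y" for y
    using assms[of y] by (simp add: inner_diff_right)
qed

lemma minorant_slopes_nonempty:
  fixes f :: "'a::euclidean_space \<Rightarrow> real"
  assumes "convex_on UNIV f"
  shows "minorant_slopes f \<noteq> {}"
  using approximate_subgradient[OF assms, of 1 0] approximate_subgradient_slope
  by (metis empty_iff zero_less_one)

text \<open>An affine minorant within \<open>\<delta>\<close> of \<open>f\<close> at one endpoint,
  evaluated at the other, gives one inequality up to \<open>\<delta>\<close>; exchanging the
  endpoints gives the other.\<close>

lemma convex_affine_direction:
  fixes f :: "'a::euclidean_space \<Rightarrow> real"
  assumes "convex_on UNIV f" and a: "\<And>s. s \<in> minorant_slopes f \<Longrightarrow> inner s w = a"
  shows "f (x + w) = f x + a"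
proof (rule antisym)
  show "f (x + w) \<le> f x + a"
  proof (rule field_le_epsilon)
    fix \<delta> :: real assume "\<delta> > 0"
    obtain s where s: "\<And>y. f (x + w) - \<delta> + inner s (y - (x + w)) \<le> f y"
      using approximate_subgradient[OF assms(1) \<open>\<delta> > 0\<close>, of "x + w"] by blast
    then show "f (x + w) \<le> f x + a + \<delta>"
      using s[of x] a[OF approximate_subgradient_slope[OF s]] by simp
  qed
  show "f x + a \<le> f (x + w)"
  proof (rule field_le_epsilon)
    fix \<delta> :: real assume "\<delta> > 0"
    obtain s where s: "\<And>y. f x - \<delta> + inner s (y - x) \<le> f y"
      using approximate_subgradient[OF assms(1) \<open>\<delta> > 0\<close>, of x] by blast
    then show "f x + a \<le> f (x + w) + \<delta>"
      using s[of "x + w"] a[OF approximate_subgradient_slope[OF s]] by simp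
  qed
qed

text \<open>For an orthonormal basis \<open>B\<close> of \<open>X\<close>, the slopes
  \<open>l + \<epsilon> *\<^sub>R b\<close> and \<open>l - \<epsilon> *\<^sub>R b\<close> bound each
  coordinate of \<open>x\<close> in absolute value. Summing over \<open>B\<close> bounds
  \<open>norm x\<close> by the triangle inequality.\<close>

lemma minorant_slopes_ball_coercive:
  fixes f :: "'a::euclidean_space \<Rightarrow> real"
  assumes "subspace X" "\<epsilon> > 0"
    and slopes: "\<And>u. \<lbrakk>u \<in> X; norm u \<le> \<epsilon>\<rbrakk> \<Longrightarrow> l + u \<in> minorant_slopes f"
  shows "\<exists>m>0. \<exists>C. \<forall>x\<in>X. m * norm x - C \<le> f x - inner l x"
proof -
  obtain B where B: "B \<subseteq> X" "pairwise orthogonal B" "\<And>b. b \<in> B \<Longrightarrow> norm b = 1"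
    "independent B" "span B = X"
    using orthonormal_basis_subspace[OF assms(1)] by metis
  have fin: "finite B"
    using B(4) by (simp add: finiteI_independent)
  have "\<exists>C. \<forall>x. \<epsilon> * \<bar>inner x b\<bar> - C \<le> f x - inner l x" if "b \<in> B" for b
  proof -
    have "\<epsilon> *\<^sub>R b \<in> X" "- \<epsilon> *\<^sub>R b \<in> X" "norm (\<epsilon> *\<^sub>R b) \<le> \<epsilon>" "norm (- \<epsilon> *\<^sub>R b) \<le> \<epsilon>"
      using that B(1,3) assms(1,2) by (auto intro: subspace_scale subspace_neg)
    then have "l + \<epsilon> *\<^sub>R b \<in> minorant_slopes f" "l + - \<epsilon> *\<^sub>R b \<in> minorant_slopes f"
      using slopes by blast+
    then obtain d e where "inner (l + \<epsilon> *\<^sub>R b) x + d \<le> f x"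
      and "inner (l + - \<epsilon> *\<^sub>R b) x + e \<le> f x" for x
      unfolding minorant_slopes_def by blast
    then have "\<epsilon> * inner x b + d \<le> f x - inner l x" "- (\<epsilon> * inner x b) + e \<le> f x - inner l x" for x
      by (simp_all add: inner_commute[of b] algebra_simps)
    moreover have "\<epsilon> * \<bar>inner x b\<bar> = \<bar>\<epsilon> * inner x b\<bar>" for x
      using assms(2) by (simp add: abs_mult)
    \<comment> \<open>The sign of \<open>inner x b\<close> decides which of the two minorants is
      used; the maximum serves both cases.\<close>
    ultimately have "\<epsilon> * \<bar>inner x b\<bar> - max (- d) (- e) \<le> f x - inner l x" for x
      by (smt (verit))
    then show ?thesis by blast
  qed
  then obtain C where C: "\<And>b x. b \<in> B \<Longrightarrow> \<epsilon> * \<bar>inner x b\<bar> - C b \<le> f x - inner l x"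
    by metis
  obtain d where d: "\<And>x. inner l x + d \<le> f x"
    using slopes[of 0] assms(1,2) by (auto simp: subspace_0 minorant_slopes_def)
  \<comment> \<open>The summand 1 covers the case \<open>B = {}\<close>.\<close>
  define N where "N = real (card B) + 1"
  have "(\<epsilon> / N) * norm x - (sum C B - d) / N \<le> f x - inner l x" if "x \<in> X" for x
  proof -
    have "norm x = norm (\<Sum>b\<in>B. inner x b *\<^sub>R b)"
      using orthonormal_basis_expand[OF B(2,3) _ fin] that B(5) by simp
    also have "\<dots> \<le> (\<Sum>b\<in>B. \<bar>inner x b\<bar>)"
      by (rule sum_norm_le) (simp add: B(3))
    finally have "\<epsilon> * norm x \<le> (\<Sum>b\<in>B. \<epsilon> * \<bar>inner x b\<bar>)"
      using assms(2) by (simp flip: sum_distrib_left)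
    also have "\<dots> \<le> (\<Sum>b\<in>B. (f x - inner l x) + C b)"
      using C by (intro sum_mono) (simp add: algebra_simps)
    also have "\<dots> = real (card B) * (f x - inner l x) + sum C B"
      by (simp add: sum.distrib)
    finally have "\<epsilon> * norm x - (sum C B - d) \<le> (f x - inner l x) * N"
      using d[of x] by (simp add: N_def algebra_simps)
    moreover have "N > 0" by (simp add: N_def)
    ultimately show ?thesis
      by (simp add: divide_le_eq flip: diff_divide_distrib)
  qed
  moreover have "\<epsilon> / N > 0"
    using assms(2) by (simp add: N_def add_nonneg_pos)
  ultimately show ?thesis by blast
qed

lemma linear_growth_essentially_coercive_on:
  assumes "m > 0" "\<And>x. x \<in> X \<Longrightarrow> m * norm x - C \<le> c x - inner l x"
  shows "essentially_coercive_on X c"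
  unfolding essentially_coercive_on_def
proof (intro exI conjI allI impI)
  show "linear_functional_on X (inner l)"
    by (simp add: linear_functional_on_def inner_add_right)
  fix x :: "nat \<Rightarrow> 'a"
  assume x: "\<forall>k. x k \<in> X" and lim: "filterlim (\<lambda>k. norm (x k)) at_top sequentially"
  have "filterlim (\<lambda>k. - C + m * norm (x k)) at_top sequentially"
    by (intro filterlim_tendsto_add_at_top[OF tendsto_const]
        filterlim_tendsto_pos_mult_at_top[OF tendsto_const assms(1) lim])
  then show "filterlim (\<lambda>k. c (x k) - inner l (x k)) at_top sequentially"
    by (rule filterlim_at_top_mono) (use assms(2) x in \<open>auto intro!: always_eventually simp: add.commute\<close>)
qed

lemma coercive_decomposition_exists:
  fixes f :: "'a::euclidean_space \<Rightarrow> real"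
  assumes "convex_on UNIV f"
  shows "\<exists>X v c. coercive_decomposition f X v c"
proof -
  let ?S = "minorant_slopes f"
  obtain l \<epsilon> where l: "l \<in> ?S" and \<epsilon>: "\<epsilon> > 0" "ball l \<epsilon> \<inter> affine hull ?S \<subseteq> ?S"
    using minorant_slopes_nonempty[OF assms] rel_interior_eq_empty[OF convex_minorant_slopes[of f]]
    by (auto simp: mem_rel_interior_ball)
  \<comment> \<open>As \<open>l\<close> is in \<open>?S\<close>, this is the direction space of the
    affine hull of \<open>?S\<close>.\<close>
  define X where "X = span ((\<lambda>s. - l + s) ` ?S)"
  have sub: "subspace X" by (simp add: X_def)
  have affine: "f (x + w) = f x + inner l w" if "w \<in> X\<^sup>\<bottom>" for x w
  proof (rule convex_affine_direction[OF assms])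
    fix s assume "s \<in> ?S"
    then have "- l + s \<in> X" unfolding X_def by (intro span_base) blast
    then have "inner (- l + s) w = 0" using that by (rule inner_orthogonal_comp)
    then show "inner s w = inner l w" by (simp add: inner_diff_left)
  qed
  \<comment> \<open>Halving the radius fits a closed ball of slopes into the open ball around
    \<open>l\<close>.\<close>
  have "l + u \<in> ?S" if "u \<in> X" "norm u \<le> \<epsilon> / 2" for u
  proof -
    have "l + u \<in> affine hull ?S"
      using that(1) affine_hull_span_gen[OF hull_inc[OF l]] by (auto simp: X_def)
    moreover have "l + u \<in> ball l \<epsilon>"
      using that(2) \<epsilon>(1) by (simp add: dist_norm)
    ultimately show ?thesis using \<epsilon>(2) by blast
  qed
  then obtain m C where mC: "m > 0" "\<And>x. x \<in> X \<Longrightarrow> m * norm x - C \<le> f x - inner l x"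
    using minorant_slopes_ball_coercive[OF sub, of "\<epsilon> / 2" l f] \<epsilon>(1) by auto
  \<comment> \<open>Only the component of \<open>l\<close> in \<open>X\<^sup>\<bottom>\<close> acts
    on \<open>X\<^sup>\<bottom>\<close>. Since it vanishes on \<open>X\<close>, the function
    \<open>c\<close> must be \<open>f\<close> itself there.\<close>
  define v where "v = l - orth_proj X l"
  define c where "c = restrict f X"
  have "essentially_coercive_on X c"
    using mC by (intro linear_growth_essentially_coercive_on[of m X C c l]) (auto simp: c_def)
  moreover have "f x = c (orth_proj X x) + inner v x" for x
  proof -
    let ?p = "orth_proj X x"
    note p = orth_proj_in[OF sub, of x] and pl = orth_proj_in[OF sub, of l]
    have "f x = f (?p + (x - ?p))" by simp
    also have "\<dots> = f ?p + inner l (x - ?p)" by (rule affine[OF p(2)])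
    also have "inner l (x - ?p) = inner v (x - ?p)"
      using inner_orthogonal_comp(1)[OF pl(1) p(2)] by (simp add: v_def inner_diff_left)
    also have "\<dots> = inner v x"
      using inner_orthogonal_comp(2)[OF p(1) pl(2)] by (simp add: v_def inner_diff_right)
    finally show ?thesis using p(1) by (simp add: c_def)
  qed
  ultimately have "coercive_decomposition f X v c"
    using sub orth_proj_in(2)[OF sub, of l] by (simp add: coercive_decomposition_def v_def c_def)
  then show ?thesis by blast
qed

theorem theorem1p11:
  fixes f :: "real ^ 'n \<Rightarrow> real"
  assumes "convex_on UNIV f"
  shows "(\<exists>!(X, v, c). coercive_decomposition f X v c) \<and>
    (\<forall>X v c Y. coercive_decomposition f X v c \<longrightarrow> subspace Y \<longrightarrow>
       essentially_coercive_in_direction Y f \<longrightarrow> Y \<subseteq> X)"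
proof
  obtain X v c where "coercive_decomposition f X v c"
    using coercive_decomposition_exists[OF assms] by blast
  then show "\<exists>!(X, v, c). coercive_decomposition f X v c"
    by (intro ex1I[of _ "(X, v, c)"]) (auto dest: coercive_decomposition_unique)
qed (blast dest: coercive_decomposition_maximal)

end
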